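(* Let $\beta\in\mathbb{R}$, $\mathbf{V}\in\mathbb{R}_+^{F\times N}$, $K\in\mathbb{N}$ and $\alpha>0$, and let $\{(\mathbf{W}_i,\mathbf{H}_i)\}_{i\in\mathbb{N}}$ be the sequence of iterates produced by the algorithm MM-SNMF-$\ell_1$ (defined in the context). Then the sequence of objective values $\big(\check{\mathcal{J}}(\mathbf{W}_i,\mathbf{H}_i)\big)_{i\in\mathbb{N}}$, where $$\check{\mathcal{J}}(\mathbf{W},\mathbf{H})=D_\beta(\mathbf{V}\mid\mathbf{W}\mathbf{H})+\alpha\|\boldsymbol{\Lambda}\mathbf{H}\|_1,\qquad \boldsymbol{\Lambda}=\mathrm{Diag}(\|\mathbf{w}_1\|_1,\ldots,\|\mathbf{w}_K\|_1),$$ is non-increasing and, because $\check{\mathcal{J}}$ is bounded below by zero, it converges.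
   Context: $\mathbf{W}$ is $F\times K$ and $\mathbf{H}$ is $K\times N$, both entrywise nonnegative; $\mathbf{w}_k$ denotes the $k$-th column of $\mathbf{W}$; $\|\cdot\|_1$ of a vector or matrix is the sum of the absolute values of its entries, so $\|\boldsymbol{\Lambda}\mathbf{H}\|_1=\sum_{k,n}\|\mathbf{w}_k\|_1h_{kn}$; $\mathbf{1}_{F\times N}$ is the all-ones $F\times N$ matrix; $\odot$, fraction bars and $^{.a}$ between/on matrices denote entrywise product, division and power. $\beta$-divergence: $D_\beta(\mathbf{V}\mid\mathbf{W}\mathbf{H})=\sum_{f=1}^F\sum_{n=1}^N d_\beta(v_{fn}\mid[\mathbf{W}\mathbf{H}]_{fn})$, where $d_1(x\mid y)=x\log\frac{x}{y}-x+y$, $d_0(x\mid y)=\frac{x}{y}-\log\frac{x}{y}-1$, and $d_\beta(x\mid y)=\frac{x^\beta}{\beta(\beta-1)}+\frac{y^\beta}{\beta}-\frac{xy^{\beta-1}}{\beta-1}$ for $\beta\notin\{0,1\}$. Exponent: $\gamma(\beta)=\frac{1}{2-\beta}$ if $\beta<1$, $\gamma(\beta)=1$ if $\beta\in[1,2]$, $\gamma(\beta)=\frac{1}{\beta-1}$ if $\beta>2$. Algorithm MM-SNMF-$\ell_1$: the input is the nonnegative matrix $\mathbf{V}$, an initialization $(\mathbf{W}_0,\mathbf{H}_0)=(\mathbf{W}_{\text{init}},\mathbf{H}_{\text{init}})$ and $\alpha>0$. For $i=0,1,2,\ldots$, given $(\mathbf{W}_i,\mathbf{H}_i)$, set $\tilde{\mathbf{V}}=\mathbf{W}_i\mathbf{H}_i$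 and $$\mathbf{H}_{i+1}=\mathbf{H}_i\odot\left(\frac{\mathbf{W}_i^\top(\mathbf{V}\odot\tilde{\mathbf{V}}^{.(\beta-2)})}{\mathbf{W}_i^\top(\tilde{\mathbf{V}}^{.(\beta-1)}+\alpha\mathbf{1}_{F\times N})}\right)^{.\gamma(\beta)};$$ then set $\tilde{\mathbf{V}}=\mathbf{W}_i\mathbf{H}_{i+1}$ and $$\mathbf{W}_{i+1}=\mathbf{W}_i\odot\left(\frac{(\mathbf{V}\odot\tilde{\mathbf{V}}^{.(\beta-2)})\mathbf{H}_{i+1}^\top}{(\tilde{\mathbf{V}}^{.(\beta-1)}+\alpha\mathbf{1}_{F\times N})\mathbf{H}_{i+1}^\top}\right)^{.\gamma(\beta)}.$$ (In practice the loop is ended by a stopping criterion and the final pair is rescaled to $(\mathbf{W}_i\boldsymbol{\Lambda}^{-1},\boldsymbol{\Lambda}\mathbf{H}_i)$; the sequence considered is that of the loop iterates.) *)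

theory Defs
  imports "HOL-Analysis.Analysis"
begin

text \<open>
  An \<open>F \<times> N\<close> matrix is a \<open>real ^ 'n ^ 'f\<close>. On this type \<open>A + B\<close>, \<open>A * B\<close> and \<open>1\<close> are the library's
  componentwise operations, so \<open>A * B\<close> is the Hadamard product and \<open>1\<close> the all-ones matrix;
  \<open>A ** B\<close> is the matrix product.
\<close>

definition nonneg_mat :: "real ^ 'n ^ 'm \<Rightarrow> bool" where
  "nonneg_mat A \<longleftrightarrow> (\<forall>i j. 0 \<le> A $ i $ j)"

definition mat_div :: "real ^ 'n ^ 'm \<Rightarrow> real ^ 'n ^ 'm \<Rightarrow> real ^ 'n ^ 'm" where
  "mat_div A B = (\<chi> i j. A $ i $ j / B $ i $ j)"

definition mat_powr :: "real ^ 'n ^ 'm \<Rightarrow> real \<Rightarrow> real ^ 'n ^ 'm" where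
  "mat_powr A a = (\<chi> i j. A $ i $ j powr a)"

definition vec_l1 :: "real ^ 'm \<Rightarrow> real" where
  "vec_l1 x = (\<Sum>i\<in>UNIV. \<bar>x $ i\<bar>)"

definition mat_l1 :: "real ^ 'n ^ 'm \<Rightarrow> real" where
  "mat_l1 A = (\<Sum>i\<in>UNIV. \<Sum>j\<in>UNIV. \<bar>A $ i $ j\<bar>)"

definition diag_mat :: "real ^ 'k \<Rightarrow> real ^ 'k ^ 'k" where
  "diag_mat d = (\<chi> i j. if i = j then d $ i else 0)"

definition beta_formula :: "real \<Rightarrow> real \<Rightarrow> real \<Rightarrow> real" where
  "beta_formula \<beta> x y =
    (if \<beta> = 1 then x * ln (x / y) - x + y
     else if \<beta> = 0 then x / y - ln (x / y) - 1
     else x powr \<beta> / (\<beta> * (\<beta> - 1)) + y powr \<beta> / \<beta> - x * y powr (\<beta> - 1) / (\<beta> - 1))"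

text \<open>
  The formula is meant for \<open>x, y > 0\<close>. As one of \<open>x, y\<close> tends to \<open>0\<close> and the other stays positive,
  it tends to \<open>\<infinity>\<close> for \<open>x = 0\<close>, \<open>\<beta> \<le> 0\<close> and for \<open>y = 0\<close>, \<open>\<beta> \<le> 1\<close>. These values are set explicitly,
  because \<open>ln 0\<close>, \<open>x / 0\<close> and \<open>0 powr a\<close> are all \<open>0\<close> in HOL. In the remaining boundary cases this
  makes the formula agree with the usual \<open>0 log 0 = 0\<close> and \<open>0 \<cdot> \<infinity> = 0\<close>; in particular
  \<open>d\<^sub>\<beta>(0 | 0) = 0\<close> for \<open>\<beta> > 0\<close>. For \<open>\<beta> \<le> 0\<close>, where the formula is undefined at \<open>(0, 0)\<close>,
  \<open>d\<^sub>\<beta>(0 | 0)\<close> is the limit \<open>\<infinity>\<close> of \<open>d\<^sub>\<beta>(0 | y)\<close>.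
\<close>

definition beta_div :: "real \<Rightarrow> real \<Rightarrow> real \<Rightarrow> ereal" where
  "beta_div \<beta> x y =
    (if x = 0 \<and> \<beta> \<le> 0 \<or> x > 0 \<and> y = 0 \<and> \<beta> \<le> 1 then \<infinity> else ereal (beta_formula \<beta> x y))"

definition beta_divergence :: "real \<Rightarrow> real ^ 'n ^ 'f \<Rightarrow> real ^ 'n ^ 'f \<Rightarrow> ereal" where
  "beta_divergence \<beta> V Y = (\<Sum>f\<in>UNIV. \<Sum>n\<in>UNIV. beta_div \<beta> (V $ f $ n) (Y $ f $ n))"

definition Lambda :: "real ^ 'k ^ 'f \<Rightarrow> real ^ 'k ^ 'k" where
  "Lambda W = diag_mat (\<chi> k. vec_l1 (column k W))"

definition objective ::
    "real \<Rightarrow> real \<Rightarrow> real ^ 'n ^ 'f \<Rightarrow> real ^ 'k ^ 'f \<Rightarrow> real ^ 'n ^ 'k \<Rightarrow> ereal" where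
  "objective \<beta> \<alpha> V W H = beta_divergence \<beta> V (W ** H) + ereal (\<alpha> * mat_l1 (Lambda W ** H))"

definition mm_exponent :: "real \<Rightarrow> real" where
  "mm_exponent \<beta> = (if \<beta> < 1 then 1 / (2 - \<beta>) else if \<beta> \<le> 2 then 1 else 1 / (\<beta> - 1))"

text \<open>
  The values HOL gives to powers of zero do not matter in the updates: if \<open>(W ** H) $ f $ n = 0\<close>
  for nonnegative \<open>W\<close> and \<open>H\<close>, then for each \<open>k\<close> either \<open>W $ f $ k = 0\<close>, and the \<open>(f, n)\<close> entry has
  weight \<open>0\<close> in the quotient for \<open>H $ k $ n\<close>, or \<open>H $ k $ n = 0\<close> and it stays \<open>0\<close>; likewise for \<open>W\<close>.
  A denominator vanishes only if a whole column of \<open>W\<close> or row of \<open>H\<close> is zero, and then \<open>0 / 0 = 0\<close>.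
\<close>

definition H_update ::
    "real \<Rightarrow> real \<Rightarrow> real ^ 'n ^ 'f \<Rightarrow> real ^ 'k ^ 'f \<Rightarrow> real ^ 'n ^ 'k \<Rightarrow> real ^ 'n ^ 'k" where
  "H_update \<beta> \<alpha> V W H =
    (let Y = W ** H in
      H * mat_powr
            (mat_div (transpose W ** (V * mat_powr Y (\<beta> - 2)))
                     (transpose W ** (mat_powr Y (\<beta> - 1) + \<alpha> *\<^sub>R 1)))
            (mm_exponent \<beta>))"

definition W_update ::
    "real \<Rightarrow> real \<Rightarrow> real ^ 'n ^ 'f \<Rightarrow> real ^ 'k ^ 'f \<Rightarrow> real ^ 'n ^ 'k \<Rightarrow> real ^ 'k ^ 'f" where
  "W_update \<beta> \<alpha> V W H =
    (let Y = W ** H in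
      W * mat_powr
            (mat_div ((V * mat_powr Y (\<beta> - 2)) ** transpose H)
                     ((mat_powr Y (\<beta> - 1) + \<alpha> *\<^sub>R 1) ** transpose H))
            (mm_exponent \<beta>))"

primrec mm_snmf ::
    "real \<Rightarrow> real \<Rightarrow> real ^ 'n ^ 'f \<Rightarrow> real ^ 'k ^ 'f \<Rightarrow> real ^ 'n ^ 'k
      \<Rightarrow> nat \<Rightarrow> (real ^ 'k ^ 'f) \<times> (real ^ 'n ^ 'k)" where
  "mm_snmf \<beta> \<alpha> V W_init H_init 0 = (W_init, H_init)"
| "mm_snmf \<beta> \<alpha> V W_init H_init (Suc i) =
    (let (W, H) = mm_snmf \<beta> \<alpha> V W_init H_init i;
         H' = H_update \<beta> \<alpha> V W H
     in (W_update \<beta> \<alpha> V W H', H'))"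

end

theory Submission
  imports Defs
begin

text \<open>
  Since \<open>\<alpha> \<parallel>\<Lambda>H\<parallel>\<^sub>1 = \<alpha> \<Sum> [WH]\<^sub>f\<^sub>n\<close>, the objective is a sum of scalar costs \<open>d\<^sub>\<beta>(v | y) + \<alpha> y\<close> at the
  entries of \<open>WH\<close>, so the two updates are transposes of each other and split into independent vector
  problems. With \<open>L\<^sub>a(r) = (r\<^sup>a - 1) / a\<close> (and \<open>L\<^sub>0 = ln\<close>) one has
  \<open>d\<^sub>\<beta>(x | ys) - d\<^sub>\<beta>(x | y) = y\<^sup>\<beta> L\<^sub>\<beta>(s) - x y\<^bsup>\<beta>-1\<^esup> L\<^bsub>\<beta>-1\<^esub>(s)\<close>. Everything follows from the fact that
  \<open>L\<^sub>a(r)\<close> is increasing in \<open>a\<close>: replacing \<open>\<beta>\<close> by \<open>a = max 1 \<beta>\<close> and \<open>\<beta> - 1\<close> by \<open>b = min 1 (\<beta> - 1)\<close>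
  majorizes the cost, \<open>L\<^sub>a\<close> is convex and \<open>L\<^sub>b\<close> concave so that the majorizer separates over \<open>k\<close>,
  and \<open>\<gamma>(\<beta>) = 1 / (a - b)\<close> is the exponent in the minimizer of the separated majorizer.
\<close>

section \<open>Box-Cox functions L_a: monotonicity in the exponent, tangents, Jensen,
  minimization\<close>

definition box_cox :: "real \<Rightarrow> real \<Rightarrow> real" where
  "box_cox a r = (if a = 0 then ln r else (r powr a - 1) / a)"

lemma box_cox_1 [simp]: "box_cox a 1 = 0"
  by (simp add: box_cox_def)

lemma box_cox_one: "0 \<le> r \<Longrightarrow> box_cox 1 r = r - 1"
  by (simp add: box_cox_def)

text \<open>For a > 0 this is the limit at 0. For a < 0 the limit is -infinity, so the concave
  estimates below demand positive arguments.\<close>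

lemma box_cox_0: "a \<noteq> 0 \<Longrightarrow> box_cox a 0 = - 1 / a"
  by (simp add: box_cox_def)

lemma DERIV_box_cox:
  assumes "0 < r"
  shows "(box_cox a has_real_derivative r powr (a - 1)) (at r)"
proof (cases "a = 0")
  case True
  have "box_cox a = ln"
    using True by (simp add: box_cox_def fun_eq_iff)
  moreover have "r powr (a - 1) = 1 / r"
    using True assms by (simp add: powr_minus_divide)
  ultimately show ?thesis
    using assms by (auto intro!: derivative_eq_intros)
next
  case False
  have "((\<lambda>r. (r powr a - 1) / a) has_real_derivative r powr (a - 1)) (at r)"
    using False assms by (auto intro!: derivative_eq_intros)
  moreover have "box_cox a = (\<lambda>r. (r powr a - 1) / a)"
    using False by (simp add: box_cox_def fun_eq_iff)
  ultimately show ?thesis by simp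
qed

text \<open>Both functions vanish at 1, and the derivative x^(b-1) - x^(a-1) of their difference is
  nonnegative right of 1 and nonpositive left of 1. The mean value theorem between r and 1
  concludes.\<close>

lemma box_cox_mono_exponent:
  assumes "0 < r" "a \<le> b"
  shows "box_cox a r \<le> box_cox b r"
proof -
  define g where "g = (\<lambda>r. box_cox b r - box_cox a r)"
  have D: "(g has_real_derivative x powr (b - 1) - x powr (a - 1)) (at x)" if "0 < x" for x
    unfolding g_def using that by (intro DERIV_diff DERIV_box_cox)
  consider "r = 1" | "1 < r" | "r < 1" by linarith
  then have "0 \<le> g r"
  proof cases
    case 1
    then show ?thesis by (simp add: g_def)
  next
    case 2
    obtain z where z: "1 < z" "g r - g 1 = (r - 1) * (z powr (b - 1) - z powr (a - 1))"
      using MVT2[OF 2, of g "\<lambda>x. x powr (b - 1) - x powr (a - 1)"] D by auto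
    have "z powr (a - 1) \<le> z powr (b - 1)"
      using z assms by (intro powr_mono) auto
    then show ?thesis
      using z 2 by (simp add: g_def)
  next
    case 3
    obtain z where z: "r < z" "z < 1" "g 1 - g r = (1 - r) * (z powr (b - 1) - z powr (a - 1))"
      using MVT2[OF 3, of g "\<lambda>x. x powr (b - 1) - x powr (a - 1)"] D assms by auto
    have "z powr (b - 1) \<le> z powr (a - 1)"
      using z assms by (intro powr_mono') auto
    then have "(1 - r) * (z powr (b - 1) - z powr (a - 1)) \<le> 0"
      using 3 by (intro mult_nonneg_nonpos) auto
    then show ?thesis
      using z by (simp add: g_def)
  qed
  then show ?thesis by (simp add: g_def)
qed

text \<open>The point 0 can be included for positive exponents, where the values are -1/a and
  -1/b.\<close>

lemma box_cox_mono_exponent':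
  assumes "0 \<le> r" "0 < a" "a \<le> b"
  shows "box_cox a r \<le> box_cox b r"
proof (cases "r = 0")
  case True
  then show ?thesis using assms by (simp add: box_cox_0 frac_le)
next
  case False
  then show ?thesis using assms by (intro box_cox_mono_exponent) auto
qed

text \<open>The law ln(st) = ln s + ln t carried over to all exponents; it moves the base point of
  an estimate from s to 1.\<close>

lemma box_cox_mult:
  assumes "0 < s" "0 < t \<or> a \<noteq> 0 \<and> 0 \<le> t"
  shows "box_cox a (s * t) = box_cox a s + s powr a * box_cox a t"
  using assms by (auto simp: box_cox_def ln_mult powr_mult field_simps)

text \<open>After rescaling by s this is the tangent at 1, L_b(t) \<le> t - 1 = L_1(t), an instance
  of monotonicity in the exponent.\<close>

lemma box_cox_tangent_concave:
  assumes "0 < r" "0 < s" "b \<le> 1"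
  shows "box_cox b r \<le> box_cox b s + s powr (b - 1) * (r - s)"
proof -
  have "box_cox b r = box_cox b s + s powr b * box_cox b (r / s)"
    using box_cox_mult[of s "r / s" b] assms by simp
  moreover have "box_cox b (r / s) \<le> r / s - 1"
    using box_cox_mono_exponent[of "r / s" b 1] assms by (simp add: box_cox_one)
  then have "s powr b * box_cox b (r / s) \<le> s powr b * (r / s - 1)"
    by (intro mult_left_mono) auto
  moreover have "s powr b * (r / s - 1) = s powr (b - 1) * (r - s)"
    using assms by (simp add: powr_diff field_simps)
  ultimately show ?thesis by simp
qed

lemma box_cox_tangent_convex:
  assumes "0 \<le> r" "0 < s" "1 \<le> a"
  shows "box_cox a s + s powr (a - 1) * (r - s) \<le> box_cox a r"
proof -
  have "box_cox a r = box_cox a s + s powr a * box_cox a (r / s)"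
    using box_cox_mult[of s "r / s" a] assms by simp
  moreover have "r / s - 1 \<le> box_cox a (r / s)"
    using box_cox_mono_exponent'[of "r / s" 1 a] assms by (simp add: box_cox_one)
  then have "s powr a * (r / s - 1) \<le> s powr a * box_cox a (r / s)"
    by (intro mult_left_mono) auto
  moreover have "s powr a * (r / s - 1) = s powr (a - 1) * (r - s)"
    using assms by (simp add: powr_diff field_simps)
  ultimately show ?thesis by simp
qed

text \<open>The tangent inequality at the mean s is summed with the unnormalized weights p, and the
  linear terms cancel.\<close>

lemma box_cox_jensen_concave:
  fixes p r :: "'k \<Rightarrow> real"
  assumes "\<And>k. k \<in> K \<Longrightarrow> 0 \<le> p k" "\<And>k. k \<in> K \<Longrightarrow> 0 < p k \<Longrightarrow> 0 < r k"
    and "0 < s" "sum p K * s = (\<Sum>k\<in>K. p k * r k)" "b \<le> 1"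
  shows "(\<Sum>k\<in>K. p k * box_cox b (r k)) \<le> sum p K * box_cox b s"
proof -
  have "(\<Sum>k\<in>K. p k * box_cox b (r k)) \<le> (\<Sum>k\<in>K. p k * (box_cox b s + s powr (b - 1) * (r k - s)))"
  proof (rule sum_mono)
    fix k assume k: "k \<in> K"
    show "p k * box_cox b (r k) \<le> p k * (box_cox b s + s powr (b - 1) * (r k - s))"
    proof (cases "p k = 0")
      case False
      then show ?thesis
        using assms(1,2)[OF k] assms(3,5) by (intro mult_left_mono box_cox_tangent_concave) auto
    qed simp
  qed
  also have "\<dots> = sum p K * box_cox b s + s powr (b - 1) * ((\<Sum>k\<in>K. p k * r k) - sum p K * s)"
    by (simp add: algebra_simps sum.distrib sum_subtractf sum_distrib_left sum_distrib_right)
  finally show ?thesis using assms(4) by simp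
qed

lemma box_cox_jensen_convex:
  fixes p r :: "'k \<Rightarrow> real"
  assumes "finite K" "\<And>k. k \<in> K \<Longrightarrow> 0 \<le> p k" "\<And>k. k \<in> K \<Longrightarrow> 0 \<le> r k"
    and "0 \<le> s" "sum p K * s = (\<Sum>k\<in>K. p k * r k)" "1 \<le> a"
  shows "sum p K * box_cox a s \<le> (\<Sum>k\<in>K. p k * box_cox a (r k))"
proof (cases "s = 0")
  \<comment> \<open>A tangent needs s > 0. For s = 0 each index has \<open>p k = 0\<close> or
    \<open>r k = s\<close>, so both sides agree.\<close>
  case True
  then have "(\<Sum>k\<in>K. p k * r k) = 0" using assms(5) by simp
  then have "\<forall>k\<in>K. p k * r k = 0"
    using assms(1-3) by (subst (asm) sum_nonneg_eq_0_iff) auto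
  then have "(\<Sum>k\<in>K. p k * box_cox a (r k)) = (\<Sum>k\<in>K. p k * box_cox a s)"
    using True by (intro sum.cong) auto
  then show ?thesis by (simp add: sum_distrib_right)
next
  case False
  have "sum p K * box_cox a s =
      sum p K * box_cox a s + s powr (a - 1) * ((\<Sum>k\<in>K. p k * r k) - sum p K * s)"
    using assms(5) by simp
  also have "\<dots> = (\<Sum>k\<in>K. p k * (box_cox a s + s powr (a - 1) * (r k - s)))"
    by (simp add: algebra_simps sum.distrib sum_subtractf sum_distrib_left sum_distrib_right)
  also have "\<dots> \<le> (\<Sum>k\<in>K. p k * box_cox a (r k))"
    using assms False by (intro sum_mono mult_left_mono box_cox_tangent_convex) auto
  finally show ?thesis .
qed

text \<open>For A, B > 0, r is the critical point of B L_a - A L_b, and the claim compares the value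
  there with the value 0 at 1. Substituting A = B r^(a-b) and using the inversion r^c L_{-c}(r) =
  L_c(r) reduces it to L_{-a}(r) \<le> L_{-b}(r).\<close>

lemma box_cox_minimizer:
  assumes "0 \<le> A" "0 \<le> B" "B = 0 \<Longrightarrow> A = 0" "1 \<le> a" "b < a"
    and r: "r = (A / B) powr (1 / (a - b))"
  shows "B * box_cox a r \<le> A * box_cox b r"
proof (cases "A = 0")
  case True
  then show ?thesis using assms by (simp add: box_cox_0)
next
  case False
  then have pos: "0 < A" "0 < B" using assms by force+
  then have "0 < r" using r by simp
  have A: "A = B * r powr (a - b)"
    using pos r \<open>b < a\<close> by (simp add: powr_powr)
  have inv: "r powr c * box_cox (- c) r = box_cox c r" for c
    using \<open>0 < r\<close> by (auto simp: box_cox_def powr_minus field_simps)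
  have "box_cox a r = r powr a * box_cox (- a) r" by (simp add: inv)
  also have "\<dots> \<le> r powr a * box_cox (- b) r"
    using \<open>0 < r\<close> \<open>b < a\<close> by (intro mult_left_mono box_cox_mono_exponent) auto
  also have "\<dots> = r powr (a - b) * (r powr b * box_cox (- b) r)"
    using \<open>0 < r\<close> by (simp flip: powr_add mult.assoc)
  also have "\<dots> = r powr (a - b) * box_cox b r" by (simp add: inv)
  finally show ?thesis using pos by (simp add: A)
qed

text \<open>The pair (max, min) is (1, \<beta> - 1) for \<beta> < 1, (\<beta>, \<beta> - 1) on
  [1, 2] and (\<beta>, 1) for \<beta> > 2.\<close>

lemma mm_exponent_eq: "mm_exponent \<beta> = 1 / (max 1 \<beta> - min 1 (\<beta> - 1))"
  by (auto simp: mm_exponent_def max_def min_def)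

section \<open>The \<beta>-divergence: scaling, nonnegativity, majorization\<close>

text \<open>Terms in x alone cancel, leaving differences of powers or logarithms of y. For x = 0 the
  second term drops out, so s = 0 is admissible when \<beta> > 0.\<close>

lemma beta_formula_scale:
  assumes "0 < y" "0 < x \<and> 0 < s \<or> x = 0 \<and> 0 \<le> s \<and> 0 < \<beta>"
  shows "beta_formula \<beta> x (y * s) - beta_formula \<beta> x y =
    y powr \<beta> * box_cox \<beta> s - x * y powr (\<beta> - 1) * box_cox (\<beta> - 1) s"
proof -
  consider "\<beta> = 1" | "\<beta> = 0" | "\<beta> \<noteq> 0" "\<beta> \<noteq> 1" by blast
  then show ?thesis
  proof cases
    case 1
    then show ?thesis
      using assms by (auto simp: beta_formula_def box_cox_def ln_mult ln_div algebra_simps)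
  next
    case 2
    then show ?thesis
      using assms
      by (auto simp: beta_formula_def box_cox_def ln_mult ln_div powr_minus field_simps)
  next
    case 3
    have "(y * s) powr c = y powr c * s powr c" for c
      using assms by (auto simp: powr_mult)
    with 3 show ?thesis
      using assms by (simp add: beta_formula_def box_cox_def divide_simps) (simp add: algebra_simps)
  qed
qed

lemma beta_formula_self: "0 < x \<Longrightarrow> beta_formula \<beta> x x = 0"
proof -
  assume "0 < x"
  then have "x * x powr (\<beta> - 1) = x powr \<beta>" by (simp add: powr_diff)
  then show ?thesis
    using \<open>0 < x\<close> by (simp add: beta_formula_def divide_simps) (simp add: algebra_simps)
qed

text \<open>Scaling from y = x gives d(x | y) = x^\<beta> (L_\<beta>(y/x) - L_{\<beta>-1}(y/x)), so
  this is again monotonicity in the exponent; the boundary values are checked directly.\<close>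

lemma beta_div_nonneg:
  assumes "0 \<le> x" "0 \<le> y"
  shows "0 \<le> beta_div \<beta> x y"
proof (cases "0 < x \<and> 0 < y")
  case True
  then have "beta_formula \<beta> x y = x powr \<beta> * (box_cox \<beta> (y / x) - box_cox (\<beta> - 1) (y / x))"
    using beta_formula_scale[of x x "y / x" \<beta>]
    by (simp add: beta_formula_self powr_diff algebra_simps)
  also have "\<dots> \<ge> 0"
    using True by (simp add: box_cox_mono_exponent)
  finally show ?thesis by (simp add: beta_div_def)
next
  case False
  then have "x = 0 \<or> y = 0" using assms by linarith
  then show ?thesis
    using assms by (auto simp: beta_div_def beta_formula_def)
qed

text \<open>\<open>p k\<close> is the share of component k in the entry y and \<open>r k\<close> the
  factor by which it changes. The right-hand side is a sum over k in which each term involves only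
  its own \<open>r k\<close>.\<close>

lemma beta_div_majorize:
  fixes p r :: "'k \<Rightarrow> real"
  assumes K: "finite K"
    and p: "\<And>k. k \<in> K \<Longrightarrow> 0 \<le> p k" and r: "\<And>k. k \<in> K \<Longrightarrow> 0 \<le> r k"
    and x: "0 \<le> x" "\<And>k. k \<in> K \<Longrightarrow> 0 < x \<Longrightarrow> 0 < p k \<Longrightarrow> 0 < r k"
    and "0 \<le> \<alpha>"
    and fin: "beta_div \<beta> x y \<noteq> \<infinity>"
    and y: "y = sum p K" and y': "y' = (\<Sum>k\<in>K. p k * r k)"
  defines "a \<equiv> max 1 \<beta>" and "b \<equiv> min 1 (\<beta> - 1)"
  shows "beta_div \<beta> x y' + ereal (\<alpha> * y') \<le> beta_div \<beta> x y + ereal (\<alpha> * y) +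
    ereal (\<Sum>k\<in>K. p k * ((y powr (\<beta> - 1) + \<alpha>) * box_cox a (r k)
                           - x * y powr (\<beta> - 2) * box_cox b (r k)))"
proof (cases "y = 0")
  case True
  then have "\<forall>k\<in>K. p k = 0"
    using y p K by (simp add: sum_nonneg_eq_0_iff)
  then show ?thesis using True by (simp add: y')
next
  case False
  have "0 \<le> y" using y p by (simp add: sum_nonneg)
  with False have "0 < y" by simp
  \<comment> \<open>The relative change of the entry is the p-weighted mean of the
    \<open>r k\<close>.\<close>
  define s where "s = y' / y"
  have s: "sum p K * s = (\<Sum>k\<in>K. p k * r k)" and ys: "y' = y * s"
    using \<open>0 < y\<close> by (simp_all add: s_def y y')
  have "0 \<le> y'" unfolding y' using p r by (intro sum_nonneg mult_nonneg_nonneg) auto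
  then have "0 \<le> s" using \<open>0 < y\<close> by (simp add: s_def)
  have s_pos: "0 < s" if "0 < x"
  proof -
    obtain k where k: "k \<in> K" "p k \<noteq> 0"
      using \<open>0 < y\<close> y by (metis less_irrefl sum.neutral)
    then have "0 < p k" using p[of k] by simp
    then have "0 < p k * r k" using x(2)[OF k(1) that] by simp
    then have "0 < y'"
      unfolding y' using K k(1) p r by (intro sum_pos2[of K k]) auto
    then show ?thesis using \<open>0 < y\<close> by (simp add: s_def)
  qed
  \<comment> \<open>Finiteness at y excludes \<open>x = 0\<close> with \<beta> \<le> 0; for x > 0
    the new value stays positive.\<close>
  have cond: "0 < x \<and> 0 < s \<or> x = 0 \<and> 0 \<le> s \<and> 0 < \<beta>"
    using fin x(1) s_pos \<open>0 \<le> s\<close> by (cases "x = 0") (auto simp: beta_div_def split: if_splits)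
  have "1 \<le> a" "b \<le> 1" by (auto simp: a_def b_def)
  have La: "box_cox \<beta> s \<le> box_cox a s"
    using cond box_cox_mono_exponent[of s \<beta> a] box_cox_mono_exponent'[of s \<beta> a] by (auto simp: a_def)
  \<comment> \<open>The penalty changes by \<alpha> y (s - 1). Absorbing it into L_a produces the
    \<alpha> in the denominator of the update.\<close>
  have L1: "s - 1 \<le> box_cox a s"
    using box_cox_mono_exponent'[of s 1 a] \<open>0 \<le> s\<close> \<open>1 \<le> a\<close> by (simp add: box_cox_one)
  have Lb: "x * box_cox b s \<le> x * box_cox (\<beta> - 1) s"
    using cond box_cox_mono_exponent[of s b "\<beta> - 1"] by (auto simp: b_def)
  have Ja: "y * box_cox a s \<le> (\<Sum>k\<in>K. p k * box_cox a (r k))"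
    unfolding y using K p r \<open>0 \<le> s\<close> s \<open>1 \<le> a\<close> by (rule box_cox_jensen_convex)
  have Jb: "x * (\<Sum>k\<in>K. p k * box_cox b (r k)) \<le> x * (y * box_cox b s)"
  proof (cases "x = 0")
    case False
    then have "0 < x" using x by simp
    show ?thesis unfolding y
      using \<open>0 < x\<close> p x(2)[OF _ \<open>0 < x\<close>] s_pos[OF \<open>0 < x\<close>] s \<open>b \<le> 1\<close>
      by (intro mult_left_mono box_cox_jensen_concave) auto
  qed simp
  \<comment> \<open>A factor y is split off because the Jensen weights have total mass y.\<close>
  have pw: "y powr \<beta> = y * y powr (\<beta> - 1)" "y powr (\<beta> - 1) = y * y powr (\<beta> - 2)"
    using \<open>0 < y\<close> by (simp_all add: powr_diff field_simps power2_eq_square flip: powr_realpow)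
  have "beta_formula \<beta> x y' + \<alpha> * y' - (beta_formula \<beta> x y + \<alpha> * y)
      = y powr \<beta> * box_cox \<beta> s + \<alpha> * y * (s - 1) - y powr (\<beta> - 1) * (x * box_cox (\<beta> - 1) s)"
    using beta_formula_scale[OF \<open>0 < y\<close> cond] by (simp add: ys algebra_simps)
  also have "\<dots> \<le> y powr \<beta> * box_cox a s + \<alpha> * y * box_cox a s - y powr (\<beta> - 1) * (x * box_cox b s)"
    using \<open>0 \<le> \<alpha>\<close> \<open>0 \<le> y\<close>
    by (intro diff_mono add_mono mult_left_mono[OF La] mult_left_mono[OF L1] mult_left_mono[OF Lb]) auto
  also have "\<dots> = (y powr (\<beta> - 1) + \<alpha>) * (y * box_cox a s) - y powr (\<beta> - 2) * (x * (y * box_cox b s))"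
    by (simp add: pw algebra_simps)
  also have "\<dots> \<le> (y powr (\<beta> - 1) + \<alpha>) * (\<Sum>k\<in>K. p k * box_cox a (r k))
      - y powr (\<beta> - 2) * (x * (\<Sum>k\<in>K. p k * box_cox b (r k)))"
    using \<open>0 \<le> \<alpha>\<close> by (intro diff_mono mult_left_mono[OF Ja] mult_left_mono[OF Jb]) auto
  also have "\<dots> = (\<Sum>k\<in>K. p k * ((y powr (\<beta> - 1) + \<alpha>) * box_cox a (r k)
                           - x * y powr (\<beta> - 2) * box_cox b (r k)))"
    by (simp add: algebra_simps sum_subtractf sum.distrib sum_distrib_left)
  finally have le: "beta_formula \<beta> x y' + \<alpha> * y' \<le> beta_formula \<beta> x y + \<alpha> * y + \<dots>" by simp
  have "beta_div \<beta> x y' = ereal (beta_formula \<beta> x y')"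
    using cond ys \<open>0 < y\<close> by (auto simp: beta_div_def)
  moreover have "beta_div \<beta> x y = ereal (beta_formula \<beta> x y)"
    using fin by (simp add: beta_div_def split: if_splits)
  ultimately show ?thesis using le by simp
qed

section \<open>Descent for one vector update\<close>

text \<open>Stated for a vector h and fixed weights w so that it serves both a column of H and a row
  of W.\<close>

lemma mm_step_descent:
  fixes w :: "'f \<Rightarrow> 'k \<Rightarrow> real" and h :: "'k \<Rightarrow> real" and x :: "'f \<Rightarrow> real"
  assumes F: "finite F" and K: "finite K"
    and w: "\<And>f k. 0 \<le> w f k" and h: "\<And>k. 0 \<le> h k" and x: "\<And>f. 0 \<le> x f" and "0 < \<alpha>"
    and y: "\<And>f. y f = (\<Sum>k\<in>K. w f k * h k)"
    and y': "\<And>f. y' f = (\<Sum>k\<in>K. w f k * h' k)"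
    and h': "\<And>k. h' k = h k * ((\<Sum>f\<in>F. w f k * (x f * y f powr (\<beta> - 2)))
                  / (\<Sum>f\<in>F. w f k * (y f powr (\<beta> - 1) + \<alpha>))) powr mm_exponent \<beta>"
  shows "(\<Sum>f\<in>F. beta_div \<beta> (x f) (y' f) + ereal (\<alpha> * y' f))
       \<le> (\<Sum>f\<in>F. beta_div \<beta> (x f) (y f) + ereal (\<alpha> * y f))"
proof (cases "\<exists>f\<in>F. beta_div \<beta> (x f) (y f) = \<infinity>")
  case True
  then have "\<exists>f\<in>F. beta_div \<beta> (x f) (y f) + ereal (\<alpha> * y f) = \<infinity>" by auto
  then have "(\<Sum>f\<in>F. beta_div \<beta> (x f) (y f) + ereal (\<alpha> * y f)) = \<infinity>"
    using F by (simp add: sum_Pinfty)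
  then show ?thesis by simp
next
  case False
  define a where "a = max 1 \<beta>"
  define b where "b = min 1 (\<beta> - 1)"
  define A where "A k = (\<Sum>f\<in>F. w f k * (x f * y f powr (\<beta> - 2)))" for k
  define B where "B k = (\<Sum>f\<in>F. w f k * (y f powr (\<beta> - 1) + \<alpha>))" for k
  define r where "r k = (A k / B k) powr mm_exponent \<beta>" for k
  \<comment> \<open>The majorizing increment split by entry and component; summing over f turns its
    coefficients into \<open>B k\<close> and \<open>A k\<close>.\<close>
  define D where "D f k = w f k * h k * ((y f powr (\<beta> - 1) + \<alpha>) * box_cox a (r k)
                           - x f * y f powr (\<beta> - 2) * box_cox b (r k))" for f k
  have D_sum: "(\<Sum>f\<in>F. D f k) = h k * (B k * box_cox a (r k) - A k * box_cox b (r k))" for k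
  proof -
    have "D f k = h k * (w f k * (y f powr (\<beta> - 1) + \<alpha>) * box_cox a (r k)
        - w f k * (x f * y f powr (\<beta> - 2)) * box_cox b (r k))" for f
      by (simp add: D_def algebra_simps)
    then show ?thesis
      by (simp only: A_def B_def sum_distrib_left[symmetric] sum_distrib_right[symmetric] sum_subtractf)
  qed
  have ab: "1 \<le> a" "b < a" by (auto simp: a_def b_def)
  have AB: "0 \<le> A k" "0 \<le> B k" for k
    using w x \<open>0 < \<alpha>\<close> by (auto simp: A_def B_def intro!: sum_nonneg mult_nonneg_nonneg add_nonneg_nonneg)
  \<comment> \<open>Where \<open>y f = 0\<close> the power may be 0 as well; then \<alpha> alone
    keeps the denominator positive.\<close>
  have B_pos: "0 < B k" if "f \<in> F" "0 < w f k" for f k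
    unfolding B_def using F that w \<open>0 < \<alpha>\<close>
    by (intro sum_pos2[of F f]) (auto intro!: mult_pos_pos mult_nonneg_nonneg add_nonneg_pos)
  have B_0: "A k = 0" if "B k = 0" for k
  proof -
    have "w f k = 0" if "f \<in> F" for f
      using B_pos[OF that, of k] \<open>B k = 0\<close> w[of f k] by force
    then show ?thesis by (simp add: A_def)
  qed
  \<comment> \<open>A positive datum reached with positive weight makes the numerator positive, so
    the update cannot annihilate that component.\<close>
  have r_pos: "0 < r k" if "f \<in> F" "k \<in> K" "0 < x f" "0 < w f k * h k" for f k
  proof -
    have "0 < w f k" using that(4) w[of f k] by (cases "w f k = 0") auto
    have "0 < y f"
      unfolding y using K that w h by (intro sum_pos2[of K k]) auto
    then have "0 < A k"
      unfolding A_def using F that w x \<open>0 < w f k\<close> by (intro sum_pos2[of F f]) auto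
    then show ?thesis
      using B_pos[OF that(1) \<open>0 < w f k\<close>] by (simp add: r_def)
  qed
  \<comment> \<open>With k outermost the components are independent scalar problems, each with value
    at \<open>r k\<close> at most the value 0 at the old iterate, factor 1.\<close>
  have D_nonpos: "(\<Sum>f\<in>F. \<Sum>k\<in>K. D f k) \<le> 0"
  proof (subst sum.swap, rule sum_nonpos)
    fix k
    have "B k * box_cox a (r k) \<le> A k * box_cox b (r k)"
      using AB B_0 ab by (rule box_cox_minimizer) (simp_all only: r_def mm_exponent_eq a_def b_def)
    then show "(\<Sum>f\<in>F. D f k) \<le> 0"
      unfolding D_sum using h by (intro mult_nonneg_nonpos) auto
  qed
  have "beta_div \<beta> (x f) (y' f) + ereal (\<alpha> * y' f)
      \<le> beta_div \<beta> (x f) (y f) + ereal (\<alpha> * y f) + ereal (\<Sum>k\<in>K. D f k)" if "f \<in> F" for f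
    unfolding D_def a_def b_def
  proof (rule beta_div_majorize)
    show "y' f = (\<Sum>k\<in>K. w f k * h k * r k)"
      by (simp add: y' h' r_def A_def B_def mult.assoc)
  qed (use K w h x r_pos that False \<open>0 < \<alpha>\<close> y in \<open>auto simp: r_def\<close>)
  then have "(\<Sum>f\<in>F. beta_div \<beta> (x f) (y' f) + ereal (\<alpha> * y' f))
      \<le> (\<Sum>f\<in>F. beta_div \<beta> (x f) (y f) + ereal (\<alpha> * y f) + ereal (\<Sum>k\<in>K. D f k))"
    by (rule sum_mono)
  also have "\<dots> = (\<Sum>f\<in>F. beta_div \<beta> (x f) (y f) + ereal (\<alpha> * y f)) + ereal (\<Sum>f\<in>F. \<Sum>k\<in>K. D f k)"
    by (simp add: sum.distrib)
  also have "\<dots> \<le> (\<Sum>f\<in>F. beta_div \<beta> (x f) (y f) + ereal (\<alpha> * y f)) + 0"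
    using D_nonpos by (intro add_left_mono) simp
  finally show ?thesis by simp
qed

section \<open>The objective as a sum over entries, and descent of the two matrix updates\<close>

lemma nonneg_mat_mult: "nonneg_mat A \<Longrightarrow> nonneg_mat B \<Longrightarrow> nonneg_mat (A ** B)"
  by (simp add: nonneg_mat_def matrix_matrix_mult_def sum_nonneg)

lemma nonneg_mat_H_update: "nonneg_mat H \<Longrightarrow> nonneg_mat (H_update \<beta> \<alpha> V W H)"
  by (simp add: nonneg_mat_def H_update_def Let_def mat_powr_def)

lemma nonneg_mat_W_update: "nonneg_mat W \<Longrightarrow> nonneg_mat (W_update \<beta> \<alpha> V W H)"
  by (simp add: nonneg_mat_def W_update_def Let_def mat_powr_def)

text \<open>By nonnegativity the absolute values disappear, and both sides are the same triple sum
  in different orders.\<close>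

lemma mat_l1_Lambda:
  fixes W :: "real ^ 'k ^ 'f" and H :: "real ^ 'n ^ 'k"
  assumes "nonneg_mat W" "nonneg_mat H"
  shows "mat_l1 (Lambda W ** H) = (\<Sum>f\<in>UNIV. \<Sum>n\<in>UNIV. (W ** H) $ f $ n)"
proof -
  have "\<bar>(Lambda W ** H) $ k $ n\<bar> = (\<Sum>f\<in>UNIV. W $ f $ k * H $ k $ n)" for k n
  proof -
    have "(Lambda W ** H) $ k $ n = (\<Sum>f\<in>UNIV. W $ f $ k) * H $ k $ n"
      using assms by (simp add: Lambda_def diag_mat_def matrix_matrix_mult_def vec_l1_def column_def
          nonneg_mat_def if_distrib[where f = "\<lambda>x. x * _"] cong: if_cong)
    then show ?thesis
      using assms by (simp add: nonneg_mat_def sum_nonneg sum_distrib_right)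
  qed
  then have "mat_l1 (Lambda W ** H) = (\<Sum>k\<in>UNIV. \<Sum>n\<in>UNIV. \<Sum>f\<in>UNIV. W $ f $ k * H $ k $ n)"
    by (simp add: mat_l1_def)
  also have "\<dots> = (\<Sum>k\<in>UNIV. \<Sum>f\<in>UNIV. \<Sum>n\<in>UNIV. W $ f $ k * H $ k $ n)"
    by (intro sum.cong refl sum.swap)
  also have "\<dots> = (\<Sum>f\<in>UNIV. \<Sum>k\<in>UNIV. \<Sum>n\<in>UNIV. W $ f $ k * H $ k $ n)"
    by (rule sum.swap)
  also have "\<dots> = (\<Sum>f\<in>UNIV. \<Sum>n\<in>UNIV. \<Sum>k\<in>UNIV. W $ f $ k * H $ k $ n)"
    by (intro sum.cong refl sum.swap)
  finally show ?thesis by (simp add: matrix_matrix_mult_def)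
qed

lemma objective_eq_sum:
  assumes "nonneg_mat W" "nonneg_mat H"
  shows "objective \<beta> \<alpha> V W H =
    (\<Sum>f\<in>UNIV. \<Sum>n\<in>UNIV. beta_div \<beta> (V $ f $ n) ((W ** H) $ f $ n) + ereal (\<alpha> * (W ** H) $ f $ n))"
  using assms
  by (simp add: objective_def beta_divergence_def mat_l1_Lambda sum.distrib sum_distrib_left)

lemma objective_nonneg:
  assumes "nonneg_mat V" "0 \<le> \<alpha>" "nonneg_mat W" "nonneg_mat H"
  shows "0 \<le> objective \<beta> \<alpha> V W H"
  using assms nonneg_mat_mult[OF assms(3,4)] unfolding objective_eq_sum[OF assms(3,4)]
  by (intro sum_nonneg add_nonneg_nonneg beta_div_nonneg) (auto simp: nonneg_mat_def)

text \<open>Each column of H is a vector update with weights W, so the sum over n is moved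
  outside.\<close>

lemma objective_H_update_le:
  fixes V :: "real ^ 'n ^ 'f" and W :: "real ^ 'k ^ 'f"
  assumes "nonneg_mat V" "0 < \<alpha>" "nonneg_mat W" "nonneg_mat H"
  shows "objective \<beta> \<alpha> V W (H_update \<beta> \<alpha> V W H) \<le> objective \<beta> \<alpha> V W H"
proof -
  have "(\<Sum>f\<in>UNIV. beta_div \<beta> (V $ f $ n) ((W ** H_update \<beta> \<alpha> V W H) $ f $ n)
            + ereal (\<alpha> * (W ** H_update \<beta> \<alpha> V W H) $ f $ n))
      \<le> (\<Sum>f\<in>UNIV. beta_div \<beta> (V $ f $ n) ((W ** H) $ f $ n) + ereal (\<alpha> * (W ** H) $ f $ n))" for n
    by (rule mm_step_descent[where K = UNIV and w = "\<lambda>f k. W $ f $ k" and h = "\<lambda>k. H $ k $ n"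
          and h' = "\<lambda>k. H_update \<beta> \<alpha> V W H $ k $ n"])
      (use assms in \<open>auto simp: nonneg_mat_def matrix_matrix_mult_def H_update_def Let_def
         mat_powr_def mat_div_def transpose_def\<close>)
  then show ?thesis
    unfolding objective_eq_sum[OF assms(3,4)]
      objective_eq_sum[OF assms(3) nonneg_mat_H_update[OF assms(4)]]
    by (subst (1 2) sum.swap) (rule sum_mono)
qed

text \<open>Each row of W is a vector update with the transpose of H as weights.\<close>

lemma objective_W_update_le:
  fixes V :: "real ^ 'n ^ 'f" and W :: "real ^ 'k ^ 'f"
  assumes "nonneg_mat V" "0 < \<alpha>" "nonneg_mat W" "nonneg_mat H"
  shows "objective \<beta> \<alpha> V (W_update \<beta> \<alpha> V W H) H \<le> objective \<beta> \<alpha> V W H"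
proof -
  have "(\<Sum>n\<in>UNIV. beta_div \<beta> (V $ f $ n) ((W_update \<beta> \<alpha> V W H ** H) $ f $ n)
            + ereal (\<alpha> * (W_update \<beta> \<alpha> V W H ** H) $ f $ n))
      \<le> (\<Sum>n\<in>UNIV. beta_div \<beta> (V $ f $ n) ((W ** H) $ f $ n) + ereal (\<alpha> * (W ** H) $ f $ n))" for f
    by (rule mm_step_descent[where K = UNIV and w = "\<lambda>n k. H $ k $ n" and h = "\<lambda>k. W $ f $ k"
          and h' = "\<lambda>k. W_update \<beta> \<alpha> V W H $ f $ k"])
      (use assms in \<open>auto simp: nonneg_mat_def matrix_matrix_mult_def W_update_def Let_def
         mat_powr_def mat_div_def transpose_def mult.commute\<close>)
  then show ?thesis
    unfolding objective_eq_sum[OF assms(3,4)]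
      objective_eq_sum[OF nonneg_mat_W_update[OF assms(3)] assms(4)]
    by (rule sum_mono)
qed

section \<open>Monotonicity and convergence of the objective values\<close>

theorem mainTheorem2:
  fixes \<beta> \<alpha> :: real
    and V :: "real ^ 'n ^ 'f"
    and W_init :: "real ^ 'k ^ 'f"
    and H_init :: "real ^ 'n ^ 'k"
    and W :: "nat \<Rightarrow> real ^ 'k ^ 'f"
    and H :: "nat \<Rightarrow> real ^ 'n ^ 'k"
  assumes "nonneg_mat V"
    and "\<alpha> > 0"
    and "nonneg_mat W_init"
    and "nonneg_mat H_init"
    and "\<And>i. (W i, H i) = mm_snmf \<beta> \<alpha> V W_init H_init i"
  shows "decseq (\<lambda>i. objective \<beta> \<alpha> V (W i) (H i))
    \<and> (\<forall>(W' :: real ^ 'k ^ 'f) (H' :: real ^ 'n ^ 'k).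
          nonneg_mat W' \<longrightarrow> nonneg_mat H' \<longrightarrow> 0 \<le> objective \<beta> \<alpha> V W' H')
    \<and> convergent (\<lambda>i. objective \<beta> \<alpha> V (W i) (H i))
    \<and> (objective \<beta> \<alpha> V (W 0) (H 0) < \<infinity> \<longrightarrow>
          (\<exists>L :: real. (\<lambda>i. objective \<beta> \<alpha> V (W i) (H i)) \<longlonglongrightarrow> ereal L))"
proof (intro conjI allI impI)
  have W0: "W 0 = W_init" and H0: "H 0 = H_init"
    using assms(5)[of 0] by simp_all
  have HS: "H (Suc i) = H_update \<beta> \<alpha> V (W i) (H i)"
    and WS: "W (Suc i) = W_update \<beta> \<alpha> V (W i) (H (Suc i))" for i
    using assms(5)[of "Suc i"] by (simp_all flip: assms(5)[of i] add: Let_def)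
  have nonneg: "nonneg_mat (W i) \<and> nonneg_mat (H i)" for i
    by (induction i)
      (use assms in \<open>auto simp: W0 H0 HS WS intro: nonneg_mat_H_update nonneg_mat_W_update\<close>)
  let ?J = "\<lambda>i. objective \<beta> \<alpha> V (W i) (H i)"
  \<comment> \<open>The intermediate pair is the old W with the new H.\<close>
  have "?J (Suc i) \<le> ?J i" for i
  proof -
    have "?J (Suc i) \<le> objective \<beta> \<alpha> V (W i) (H (Suc i))"
      unfolding WS using assms nonneg by (intro objective_W_update_le) auto
    also have "\<dots> \<le> ?J i"
      unfolding HS using assms nonneg by (intro objective_H_update_le) auto
    finally show ?thesis .
  qed
  then show dec: "decseq ?J" by (rule decseq_SucI)
  show "0 \<le> objective \<beta> \<alpha> V W' H'"
    if "nonneg_mat W'" "nonneg_mat H'" for W' :: "real ^ 'k ^ 'f" and H' :: "real ^ 'n ^ 'k"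
    using assms that by (intro objective_nonneg) auto
  \<comment> \<open>In the extended reals a decreasing sequence tends to its infimum, even if it
    starts at infinity.\<close>
  have lim: "?J \<longlonglongrightarrow> (INF i. ?J i)"
    using dec by (rule LIMSEQ_INF)
  then show "convergent ?J" by (rule convergentI)
  assume "?J 0 < \<infinity>"
  \<comment> \<open>A finite start bounds the infimum above and nonnegativity bounds it below, so
    the limit is real.\<close>
  then have "(INF i. ?J i) < \<infinity>"
    by (meson INF_lower UNIV_I le_less_trans)
  moreover have "0 \<le> (INF i. ?J i)"
    using assms nonneg by (intro INF_greatest objective_nonneg) auto
  ultimately obtain L where "(INF i. ?J i) = ereal L"
    by (cases "INF i. ?J i") auto
  then show "\<exists>L. ?J \<longlonglongrightarrow> ereal L" using lim by auto
qed

end
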